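(* Let $\Omega=\{\omega_1,\dots,\omega_6\}$ and $$\mathcal{I}=\big\{\{\omega_1,\omega_2,\omega_3\},\ \{\omega_3,\omega_4,\omega_5\},\ \{\omega_5,\omega_6,\omega_1\}\big\}.$$ Let $\mathcal{B}$ be any set of partitions of $\Omega$ into exactly $3$ blocks such that $\mathcal{B}$ and $\mathcal{I}$ satisfy the $\mathscr{J}$-minimal compatibility condition and $|\mathcal{B}|\in\{3,4\}$. Let $M=M(\mathcal{B},\mathcal{I})$ be the transformation monoid on $\Omega$ constructed from $\mathcal{B}$ and $\mathcal{I}$. Then the augmentation submodule $\operatorname{Aug}(\mathbb{C}\Omega)$ is a simple $\mathbb{C}M$-module.
   Context: Let $\Omega$ be a finite set, $r\ge 1$, $\mathcal{B}$ a set of partitions of $\Omega$ into exactly $r$ (nonempty) blocks and $\mathcal{I}$ a set of $r$-element subsets of $\Omega$. $\mathcal{B}$ and $\mathcal{I}$ satisfy the $\mathscr{J}$-minimal compatibility condition if for every partition $\pi\in\mathcal{B}$ and every $I\in\mathcal{I}$, either (i) $I$ is contained in a single block of $\pi$, or (ii) $I$ contains exactly one element of each block of $\pi$. The monoid $M(\mathcal{B},\mathcal{I})$ constructed from such $\mathcal{B}$ and $\mathcal{I}$ is the set of self-maps of $\Omega$ (under composition, acting on the left) consisting of: all maps $f:\Omega\to\Omega$ whose kernel partition $\{f^{-1}(\omega)\mid\omega\in f(\Omega)\}$ belongs to $\mathcal{B}$ and whose image $f(\Omega)$ belongs to $\mathcal{I}$ (with every bijection from blocks to image points allowed); the identity map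 of $\Omega$; and all constant maps. (The first kind of maps are the nonzero elements of a Rees matrix semigroup $\mathcal{M}^0(S_r,|\mathcal{B}|,|\mathcal{I}|;P)$ with maximal subgroup the full symmetric group $S_r$, viewed as transformations.) $\mathbb{C}\Omega$ is the complex vector space with basis $\Omega$, a left $\mathbb{C}M$-module by linear extension of the action of $M$; $\operatorname{Aug}(\mathbb{C}\Omega)$ is the submodule of all linear combinations of elements of $\Omega$ whose coefficients sum to $0$. *)

theory Defs
  imports Complex_Main "HOL-Library.Disjoint_Sets" "HOL-Algebra.Module"
begin

definition J_minimal_compatible :: "'a set set set \<Rightarrow> 'a set set \<Rightarrow> bool" where
  "J_minimal_compatible \<B> \<I> \<longleftrightarrow>
     (\<forall>\<pi>\<in>\<B>. \<forall>I\<in>\<I>. (\<exists>b\<in>\<pi>. I \<subseteq> b) \<or> (\<forall>b\<in>\<pi>. \<exists>!x. x \<in> I \<inter> b))"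

definition kernel_partition :: "'a set \<Rightarrow> ('a \<Rightarrow> 'a) \<Rightarrow> 'a set set" where
  "kernel_partition \<Omega> f = (\<lambda>w. {x \<in> \<Omega>. f x = w}) ` (f ` \<Omega>)"

text \<open>Self-maps of \<open>\<Omega>\<close> are extensional functions, so that distinct functions in the carrier
  are distinct as maps on \<open>\<Omega>\<close>.\<close>

definition transformation_monoid :: "'a set \<Rightarrow> 'a set set set \<Rightarrow> 'a set set \<Rightarrow> ('a \<Rightarrow> 'a) monoid" where
  "transformation_monoid \<Omega> \<B> \<I> =
     \<lparr>carrier = {f \<in> \<Omega> \<rightarrow>\<^sub>E \<Omega>. kernel_partition \<Omega> f \<in> \<B> \<and> f ` \<Omega> \<in> \<I>}
                \<union> {\<lambda>x\<in>\<Omega>. x} \<union> {\<lambda>x\<in>\<Omega>. c | c. c \<in> \<Omega>},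
      mult = (\<lambda>f g. compose \<Omega> f g),
      one = (\<lambda>x\<in>\<Omega>. x)\<rparr>"

text \<open>Only meant for finite monoids: there is no finite-support condition. An element
  \<open>\<Sum>m. a m \<cdot> m\<close> is represented by its coefficient function \<open>a\<close>, which vanishes off the carrier.\<close>

definition monoid_algebra :: "('m, 'k) monoid_scheme \<Rightarrow> ('m \<Rightarrow> complex) ring" where
  "monoid_algebra G =
     \<lparr>carrier = {a. \<forall>m. m \<notin> carrier G \<longrightarrow> a m = 0},
      mult = (\<lambda>a b h. \<Sum>(m, n) \<in> {(m, n) \<in> carrier G \<times> carrier G. m \<otimes>\<^bsub>G\<^esub> n = h}. a m * b n),
      one = (\<lambda>m. if m = \<one>\<^bsub>G\<^esub> then 1 else 0),
      zero = (\<lambda>m. 0),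
      add = (\<lambda>a b m. a m + b m)\<rparr>"

text \<open>The locale \<open>module\<close> of the library requires a commutative ring of scalars; this is the
  same locale over an arbitrary ring. (The library's \<open>submodule\<close> makes no such requirement.)\<close>

locale left_module = R?: ring + M?: abelian_group M for M (structure) +
  assumes smult_closed:
      "\<lbrakk>a \<in> carrier R; x \<in> carrier M\<rbrakk> \<Longrightarrow> a \<odot>\<^bsub>M\<^esub> x \<in> carrier M"
    and smult_l_distr:
      "\<lbrakk>a \<in> carrier R; b \<in> carrier R; x \<in> carrier M\<rbrakk> \<Longrightarrow>
        (a \<oplus> b) \<odot>\<^bsub>M\<^esub> x = a \<odot>\<^bsub>M\<^esub> x \<oplus>\<^bsub>M\<^esub> b \<odot>\<^bsub>M\<^esub> x"
    and smult_r_distr: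
      "\<lbrakk>a \<in> carrier R; x \<in> carrier M; y \<in> carrier M\<rbrakk> \<Longrightarrow>
        a \<odot>\<^bsub>M\<^esub> (x \<oplus>\<^bsub>M\<^esub> y) = a \<odot>\<^bsub>M\<^esub> x \<oplus>\<^bsub>M\<^esub> a \<odot>\<^bsub>M\<^esub> y"
    and smult_assoc1:
      "\<lbrakk>a \<in> carrier R; b \<in> carrier R; x \<in> carrier M\<rbrakk> \<Longrightarrow>
        (a \<otimes> b) \<odot>\<^bsub>M\<^esub> x = a \<odot>\<^bsub>M\<^esub> (b \<odot>\<^bsub>M\<^esub> x)"
    and smult_one:
      "x \<in> carrier M \<Longrightarrow> \<one> \<odot>\<^bsub>M\<^esub> x = x"

definition simple_module :: "('r, 'k) ring_scheme \<Rightarrow> ('r, 'v, 'l) module_scheme \<Rightarrow> bool" where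
  "simple_module R V \<longleftrightarrow>
     left_module R V \<and> carrier V \<noteq> {\<zero>\<^bsub>V\<^esub>} \<and>
     (\<forall>N. submodule N R V \<longrightarrow> N = {\<zero>\<^bsub>V\<^esub>} \<or> N = carrier V)"

text \<open>The vector \<open>\<Sum>x\<in>\<Omega>. v x \<cdot> x\<close> is represented by its coefficient function \<open>v\<close>, which vanishes
  off \<open>\<Omega>\<close>. The coefficient of \<open>y\<close> in \<open>(\<Sum>f. a f \<cdot> f) \<odot> (\<Sum>x. v x \<cdot> x) = \<Sum>f. \<Sum>x. (a f * v x) \<cdot> f x\<close> collects
  the pairs with \<open>f x = y\<close>. The ring multiplication fields of the module record have no
  meaning here.\<close>

definition natural_module ::
    "'a set \<Rightarrow> ('a \<Rightarrow> 'a, 'k) monoid_scheme \<Rightarrow> (('a \<Rightarrow> 'a) \<Rightarrow> complex, 'a \<Rightarrow> complex) module" where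
  "natural_module \<Omega> G =
     \<lparr>carrier = {v. \<forall>x. x \<notin> \<Omega> \<longrightarrow> v x = 0},
      mult = undefined,
      one = undefined,
      zero = (\<lambda>x. 0),
      add = (\<lambda>v w x. v x + w x),
      smult = (\<lambda>a v y. \<Sum>f\<in>carrier G. \<Sum>x\<in>{x \<in> \<Omega>. f x = y}. a f * v x)\<rparr>"

definition augmentation :: "'a set \<Rightarrow> ('a \<Rightarrow> complex) set" where
  "augmentation \<Omega> = {v. (\<forall>x. x \<notin> \<Omega> \<longrightarrow> v x = 0) \<and> (\<Sum>x\<in>\<Omega>. v x) = 0}"

definition augmentation_module ::
    "'a set \<Rightarrow> ('a \<Rightarrow> 'a, 'k) monoid_scheme \<Rightarrow> (('a \<Rightarrow> 'a) \<Rightarrow> complex, 'a \<Rightarrow> complex) module" where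
  "augmentation_module \<Omega> G = (natural_module \<Omega> G)\<lparr>carrier := augmentation \<Omega>\<rparr>"

end

theory Submission
  imports Defs
begin

text \<open>Let \<open>v\<close> be a nonzero vector of a submodule \<open>N\<close> of the augmentation. If some block of some
  \<open>\<pi> \<in> \<B>\<close> has nonzero \<open>v\<close>-sum, then, the block sums adding up to \<open>0\<close>, two of them differ; as all
  bijections from the blocks onto a line \<open>I \<in> \<I>\<close> are allowed, \<open>N\<close> contains \<open>i - j\<close> for all
  \<open>i, j \<in> I\<close>. The lines form a connected hypergraph, so \<open>N\<close> contains all differences and is the
  whole augmentation. It remains to see that the partitions in \<open>\<B>\<close> separate the augmentation. The
  three lines are the sides of a triangle with vertices \<open>\<omega>\<^sub>1, \<omega>\<^sub>3, \<omega>\<^sub>5\<close> and midpoints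
  \<open>\<omega>\<^sub>2, \<omega>\<^sub>4, \<omega>\<^sub>6\<close>. Only four partitions are compatible with them: one pairs each vertex with the
  opposite midpoint, the other three consist of a side, the opposite vertex and the two remaining
  midpoints. Any three of the four already separate.\<close>

section \<open>Bilinear extensions and their associativity\<close>

text \<open>Both the product of the monoid algebra and its action on the natural module have this form, so
  a single associativity lemma covers the two associative laws.\<close>

definition bilinear_extension ::
    "('x \<Rightarrow> 'y \<Rightarrow> 'z) \<Rightarrow> 'x set \<Rightarrow> 'y set \<Rightarrow> ('x \<Rightarrow> complex) \<Rightarrow> ('y \<Rightarrow> complex) \<Rightarrow> 'z \<Rightarrow> complex" where
  "bilinear_extension h A B a b z = (\<Sum>x\<in>A. \<Sum>y\<in>B. of_bool (h x y = z) * (a x * b y))"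

lemma bilinear_extension_eq_0:
  assumes "\<And>x y. x \<in> A \<Longrightarrow> y \<in> B \<Longrightarrow> h x y \<noteq> z"
  shows "bilinear_extension h A B a b z = 0"
  using assms by (simp add: bilinear_extension_def)

lemma bilinear_extension_add_left:
  "bilinear_extension h A B (\<lambda>x. a x + a' x) b =
     (\<lambda>z. bilinear_extension h A B a b z + bilinear_extension h A B a' b z)"
  by (rule ext) (simp add: bilinear_extension_def algebra_simps sum.distrib)

lemma bilinear_extension_add_right:
  "bilinear_extension h A B a (\<lambda>y. b y + b' y) =
     (\<lambda>z. bilinear_extension h A B a b z + bilinear_extension h A B a b' z)"
  by (rule ext) (simp add: bilinear_extension_def algebra_simps sum.distrib)

text \<open>Each pair \<open>(x, y)\<close> contributes to the single coefficient at
  \<open>h x y\<close>, which lies in \<open>C\<close>, so the sum over \<open>C\<close> collapses.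
  With \<open>F\<close> an indicator this unfolds nested extensions; with \<open>F\<close>
  constantly 1 it computes coefficient sums.\<close>

lemma sum_mult_bilinear_extension:
  assumes "finite C" and "\<And>x y. x \<in> A \<Longrightarrow> y \<in> B \<Longrightarrow> h x y \<in> C"
  shows "(\<Sum>z\<in>C. F z * bilinear_extension h A B a b z) = (\<Sum>x\<in>A. \<Sum>y\<in>B. F (h x y) * (a x * b y))"
proof -
  have "(\<Sum>z\<in>C. F z * bilinear_extension h A B a b z)
      = (\<Sum>z\<in>C. \<Sum>x\<in>A. \<Sum>y\<in>B. F z * (of_bool (h x y = z) * (a x * b y)))"
    by (simp add: bilinear_extension_def sum_distrib_left)
  also have "\<dots> = (\<Sum>x\<in>A. \<Sum>y\<in>B. \<Sum>z\<in>C. F z * (of_bool (h x y = z) * (a x * b y)))"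
    by (subst sum.swap, rule sum.cong[OF refl], rule sum.swap)
  also have "\<dots> = (\<Sum>x\<in>A. \<Sum>y\<in>B. \<Sum>z\<in>C. if h x y = z then F z * (a x * b y) else 0)"
    by (intro sum.cong refl) simp
  also have "\<dots> = (\<Sum>x\<in>A. \<Sum>y\<in>B. F (h x y) * (a x * b y))"
    using assms by (intro sum.cong refl) (simp add: sum.delta')
  finally show ?thesis .
qed

text \<open>Both sides expand to the triple sum of \<open>a x * b y * c z\<close> over the triples
  whose combined value is \<open>w\<close>, and \<open>assoc\<close> identifies the two conditions.
  Four separate maps allow \<open>h\<close> to be the product of the monoid while the other three
  are the application of maps to points; \<open>P\<close> and \<open>Q\<close> are finite sets that
  hold the intermediate values.\<close>

lemma bilinear_extension_assoc:
  assumes fin: "finite P" "finite Q"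
    and P: "\<And>x y. x \<in> A \<Longrightarrow> y \<in> B \<Longrightarrow> h x y \<in> P"
    and Q: "\<And>y z. y \<in> B \<Longrightarrow> z \<in> C \<Longrightarrow> k y z \<in> Q"
    and assoc: "\<And>x y z. x \<in> A \<Longrightarrow> y \<in> B \<Longrightarrow> z \<in> C \<Longrightarrow> h' (h x y) z = k' x (k y z)"
  shows "bilinear_extension h' P C (bilinear_extension h A B a b) c
       = bilinear_extension k' A Q a (bilinear_extension k B C b c)"
proof
  fix w
  have "bilinear_extension h' P C (bilinear_extension h A B a b) c w
      = (\<Sum>z\<in>C. \<Sum>p\<in>P. (of_bool (h' p z = w) * c z) * bilinear_extension h A B a b p)"
    by (subst bilinear_extension_def, subst sum.swap) (simp add: ac_simps)
  also have "\<dots> = (\<Sum>z\<in>C. \<Sum>x\<in>A. \<Sum>y\<in>B. of_bool (h' (h x y) z = w) * c z * (a x * b y))"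
    using fin P by (intro sum.cong refl sum_mult_bilinear_extension)
  also have "\<dots> = (\<Sum>x\<in>A. \<Sum>y\<in>B. \<Sum>z\<in>C. of_bool (h' (h x y) z = w) * c z * (a x * b y))"
    by (subst sum.swap, rule sum.cong[OF refl], rule sum.swap)
  also have "\<dots> = (\<Sum>x\<in>A. \<Sum>y\<in>B. \<Sum>z\<in>C. of_bool (k' x (k y z) = w) * a x * (b y * c z))"
    by (intro sum.cong refl) (simp add: assoc)
  also have "\<dots> = (\<Sum>x\<in>A. \<Sum>q\<in>Q. (of_bool (k' x q = w) * a x) * bilinear_extension k B C b c q)"
    using fin Q by (intro sum.cong refl sum_mult_bilinear_extension[symmetric])
  also have "\<dots> = bilinear_extension k' A Q a (bilinear_extension k B C b c) w"
    by (subst (2) bilinear_extension_def) (simp add: ac_simps)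
  finally show "bilinear_extension h' P C (bilinear_extension h A B a b) c w
       = bilinear_extension k' A Q a (bilinear_extension k B C b c) w" .
qed

text \<open>The left argument is the coefficient function of the one-term element \<open>c\<close>
  times \<open>e\<close>. The case \<open>c = 1\<close> gives the unit laws; general
  \<open>c\<close> is needed when scaled monoid elements act on a submodule.\<close>

lemma bilinear_extension_delta_left:
  assumes "finite A" "e \<in> A"
  shows "bilinear_extension h A B (\<lambda>x. if x = e then c else 0) b z
       = c * (\<Sum>y\<in>B. of_bool (h e y = z) * b y)"
proof -
  have "bilinear_extension h A B (\<lambda>x. if x = e then c else 0) b z
      = (\<Sum>x\<in>A. if x = e then c * (\<Sum>y\<in>B. of_bool (h e y = z) * b y) else 0)"
    unfolding bilinear_extension_def
    by (intro sum.cong refl) (auto simp: sum_distrib_left ac_simps)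
  with assms show ?thesis by simp
qed

lemma bilinear_extension_delta_right:
  assumes "finite B" "e \<in> B"
  shows "bilinear_extension h A B a (\<lambda>y. if y = e then c else 0) z
       = c * (\<Sum>x\<in>A. of_bool (h x e = z) * a x)"
proof -
  have "(\<Sum>y\<in>B. of_bool (h x y = z) * (a x * (if y = e then c else 0)))
      = c * (of_bool (h x e = z) * a x)" for x
  proof -
    have "(\<Sum>y\<in>B. of_bool (h x y = z) * (a x * (if y = e then c else 0)))
        = (\<Sum>y\<in>B. if y = e then c * (of_bool (h x e = z) * a x) else 0)"
      by (intro sum.cong refl) auto
    with assms show ?thesis by simp
  qed
  then show ?thesis
    by (simp add: bilinear_extension_def sum_distrib_left)
qed

section \<open>The monoid algebra is a ring\<close>

lemma monoid_algebra_mult: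
  assumes "finite (carrier G)"
  shows "mult (monoid_algebra G) = bilinear_extension (mult G) (carrier G) (carrier G)"
proof (intro ext)
  fix a b h
  have "mult (monoid_algebra G) a b h
      = (\<Sum>p\<in>{p \<in> carrier G \<times> carrier G. fst p \<otimes>\<^bsub>G\<^esub> snd p = h}. a (fst p) * b (snd p))"
    by (auto simp: monoid_algebra_def intro!: sum.cong)
  also have "\<dots> = (\<Sum>p\<in>carrier G \<times> carrier G.
      of_bool (fst p \<otimes>\<^bsub>G\<^esub> snd p = h) * (a (fst p) * b (snd p)))"
    using assms by (subst sum.inter_filter, simp, intro sum.cong refl) simp
  also have "\<dots> = bilinear_extension (mult G) (carrier G) (carrier G) a b h"
    by (simp add: bilinear_extension_def sum.cartesian_product case_prod_unfold)
  finally show "mult (monoid_algebra G) a b h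
      = bilinear_extension (mult G) (carrier G) (carrier G) a b h" .
qed

lemma ring_monoid_algebra:
  assumes G: "monoid G" and fin: "finite (carrier G)"
  shows "ring (monoid_algebra G)"
proof -
  interpret G: monoid G by fact
  \<comment> \<open>What a product with the unit reduces to. For \<open>h\<close> outside the
    carrier the sum is 0, which agrees with \<open>b h\<close> because \<open>b\<close> vanishes
    there.\<close>
  have sum_carrier: "(\<Sum>n\<in>carrier G. of_bool (n = h) * b n) = b h"
    if "\<forall>m. m \<notin> carrier G \<longrightarrow> b m = 0" for b :: "'a \<Rightarrow> complex" and h
  proof -
    have "(\<Sum>n\<in>carrier G. of_bool (n = h) * b n) = (\<Sum>n\<in>carrier G. if n = h then b n else 0)"
      by (intro sum.cong) auto
    with fin that show ?thesis by simp
  qed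
  show ?thesis
  proof (rule ringI)
    show "abelian_group (monoid_algebra G)"
    proof (rule abelian_groupI)
      fix x assume "x \<in> carrier (monoid_algebra G)"
      then show "\<exists>y\<in>carrier (monoid_algebra G). y \<oplus>\<^bsub>monoid_algebra G\<^esub> x = \<zero>\<^bsub>monoid_algebra G\<^esub>"
        by (intro bexI[of _ "\<lambda>m. - x m"]) (auto simp: monoid_algebra_def)
    qed (auto simp: monoid_algebra_def)
    show "monoid (monoid_algebra G)"
    proof (rule monoidI)
      fix x y z
      assume x: "x \<in> carrier (monoid_algebra G)"
      assume y: "y \<in> carrier (monoid_algebra G)"
      show "x \<otimes>\<^bsub>monoid_algebra G\<^esub> y \<in> carrier (monoid_algebra G)"
        unfolding monoid_algebra_mult[OF fin]
        by (auto simp: monoid_algebra_def intro!: bilinear_extension_eq_0)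
      show "x \<otimes>\<^bsub>monoid_algebra G\<^esub> y \<otimes>\<^bsub>monoid_algebra G\<^esub> z =
          x \<otimes>\<^bsub>monoid_algebra G\<^esub> (y \<otimes>\<^bsub>monoid_algebra G\<^esub> z)"
        unfolding monoid_algebra_mult[OF fin]
        by (rule bilinear_extension_assoc) (auto simp: fin G.m_assoc)
      have one: "\<one>\<^bsub>monoid_algebra G\<^esub> = (\<lambda>m. if m = \<one>\<^bsub>G\<^esub> then 1 else 0)"
        by (simp add: monoid_algebra_def)
      show "\<one>\<^bsub>monoid_algebra G\<^esub> \<otimes>\<^bsub>monoid_algebra G\<^esub> x = x"
        unfolding monoid_algebra_mult[OF fin] one
        using x by (auto simp: bilinear_extension_delta_left[OF fin] monoid_algebra_def sum_carrier)
      show "x \<otimes>\<^bsub>monoid_algebra G\<^esub> \<one>\<^bsub>monoid_algebra G\<^esub> = x"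
        unfolding monoid_algebra_mult[OF fin] one
        using x by (auto simp: bilinear_extension_delta_right[OF fin] monoid_algebra_def sum_carrier)
    qed (auto simp: monoid_algebra_def)
  qed (unfold monoid_algebra_mult[OF fin],
      auto simp: monoid_algebra_def bilinear_extension_add_left bilinear_extension_add_right)
qed

section \<open>The augmentation is a left module over the monoid algebra\<close>

lemma augmentation_module_smult:
  assumes "finite \<Omega>"
  shows "smult (augmentation_module \<Omega> G) = bilinear_extension (\<lambda>f x. f x) (carrier G) \<Omega>"
proof (intro ext)
  fix a v y
  have "smult (augmentation_module \<Omega> G) a v y
      = (\<Sum>f\<in>carrier G. \<Sum>x\<in>{x \<in> \<Omega>. f x = y}. a f * v x)"
    by (simp add: augmentation_module_def natural_module_def)
  also have "\<dots> = bilinear_extension (\<lambda>f x. f x) (carrier G) \<Omega> a v y"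
    unfolding bilinear_extension_def
    using assms by (intro sum.cong[OF refl], subst sum.inter_filter, simp, intro sum.cong refl) simp
  finally show "smult (augmentation_module \<Omega> G) a v y
      = bilinear_extension (\<lambda>f x. f x) (carrier G) \<Omega> a v y" .
qed

lemma left_module_augmentation_module:
  assumes fin: "finite \<Omega>" and G: "monoid G"
    and carrier: "carrier G \<subseteq> \<Omega> \<rightarrow>\<^sub>E \<Omega>"
    and mult: "\<And>f g. f \<otimes>\<^bsub>G\<^esub> g = compose \<Omega> f g"
    and one: "\<one>\<^bsub>G\<^esub> = (\<lambda>x\<in>\<Omega>. x)"
  shows "left_module (monoid_algebra G) (augmentation_module \<Omega> G)"
proof -
  interpret G: monoid G by fact
  have finG: "finite (carrier G)"
    using carrier finite_PiE[OF fin fin] by (rule finite_subset)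
  have app: "f x \<in> \<Omega>" if "f \<in> carrier G" "x \<in> \<Omega>" for f x
    using that carrier by auto
  have carrier_aug: "carrier (augmentation_module \<Omega> G) = augmentation \<Omega>"
    by (simp add: augmentation_module_def)
  note smult = augmentation_module_smult[OF fin]
  show ?thesis
  proof (intro left_module.intro left_module_axioms.intro)
    show "ring (monoid_algebra G)"
      by (rule ring_monoid_algebra[OF G finG])
    show "abelian_group (augmentation_module \<Omega> G)"
    proof (rule abelian_groupI)
      fix x assume "x \<in> carrier (augmentation_module \<Omega> G)"
      then show "\<exists>y\<in>carrier (augmentation_module \<Omega> G).
          y \<oplus>\<^bsub>augmentation_module \<Omega> G\<^esub> x = \<zero>\<^bsub>augmentation_module \<Omega> G\<^esub>"
        by (intro bexI[of _ "\<lambda>m. - x m"])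
          (auto simp: augmentation_module_def natural_module_def augmentation_def sum_negf)
    qed (auto simp: augmentation_module_def natural_module_def augmentation_def sum.distrib)
  next
    fix a b x y
    assume x: "x \<in> carrier (augmentation_module \<Omega> G)"
    \<comment> \<open>A self-map of \<Omega> only relocates coefficients, so \<open>a\<close>
      multiplies the coefficient sum of \<open>x\<close> by that of \<open>a\<close>; a zero sum
      therefore stays zero.\<close>
    have "(\<Sum>y\<in>\<Omega>. bilinear_extension (\<lambda>f x. f x) (carrier G) \<Omega> a x y)
        = (\<Sum>f\<in>carrier G. a f * (\<Sum>z\<in>\<Omega>. x z))"
      using sum_mult_bilinear_extension[where F = "\<lambda>_. 1" and a = a and b = x, OF fin app]
      by (simp add: sum_distrib_left)
    then show "a \<odot>\<^bsub>augmentation_module \<Omega> G\<^esub> x \<in> carrier (augmentation_module \<Omega> G)"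
      using x app unfolding smult carrier_aug augmentation_def
      by (auto intro!: bilinear_extension_eq_0)
    show "(a \<oplus>\<^bsub>monoid_algebra G\<^esub> b) \<odot>\<^bsub>augmentation_module \<Omega> G\<^esub> x =
        a \<odot>\<^bsub>augmentation_module \<Omega> G\<^esub> x \<oplus>\<^bsub>augmentation_module \<Omega> G\<^esub> b \<odot>\<^bsub>augmentation_module \<Omega> G\<^esub> x"
      unfolding smult
      by (auto simp: augmentation_module_def natural_module_def monoid_algebra_def
          bilinear_extension_add_left)
    show "a \<odot>\<^bsub>augmentation_module \<Omega> G\<^esub> (x \<oplus>\<^bsub>augmentation_module \<Omega> G\<^esub> y) =
        a \<odot>\<^bsub>augmentation_module \<Omega> G\<^esub> x \<oplus>\<^bsub>augmentation_module \<Omega> G\<^esub> a \<odot>\<^bsub>augmentation_module \<Omega> G\<^esub> y"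
      unfolding smult
      by (auto simp: augmentation_module_def natural_module_def bilinear_extension_add_right)
    \<comment> \<open>Here the hypothesis of the associativity lemma is that the composite of
      \<open>f\<close> and \<open>g\<close> sends \<open>x\<close> to \<open>f (g x)\<close> for
      \<open>x\<close> in \<Omega>.\<close>
    show "(a \<otimes>\<^bsub>monoid_algebra G\<^esub> b) \<odot>\<^bsub>augmentation_module \<Omega> G\<^esub> x =
        a \<odot>\<^bsub>augmentation_module \<Omega> G\<^esub> (b \<odot>\<^bsub>augmentation_module \<Omega> G\<^esub> x)"
      unfolding smult monoid_algebra_mult[OF finG]
      by (rule bilinear_extension_assoc, simp_all add: fin finG app) (simp add: mult compose_def)
    have "(\<Sum>z\<in>\<Omega>. of_bool (\<one>\<^bsub>G\<^esub> z = y) * x z) = x y" for y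
    proof -
      have "(\<Sum>z\<in>\<Omega>. of_bool (\<one>\<^bsub>G\<^esub> z = y) * x z) = (\<Sum>z\<in>\<Omega>. if z = y then x z else 0)"
        by (intro sum.cong) (auto simp: one)
      with fin x show ?thesis by (auto simp: carrier_aug augmentation_def)
    qed
    then show "\<one>\<^bsub>monoid_algebra G\<^esub> \<odot>\<^bsub>augmentation_module \<Omega> G\<^esub> x = x"
      unfolding smult
      by (auto simp: monoid_algebra_def bilinear_extension_delta_left[OF finG])
  qed
qed

section \<open>The transformation monoid\<close>

lemma carrier_transformation_monoid_subset:
  "carrier (transformation_monoid \<Omega> \<B> \<I>) \<subseteq> \<Omega> \<rightarrow>\<^sub>E \<Omega>"
  by (auto simp: transformation_monoid_def)

text \<open>This is where compatibility makes \<open>M\<close> a monoid. If neither factor is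
  constant or the identity, the image of \<open>g\<close> either lies in one block of the kernel of
  \<open>f\<close>, and the composite is constant, or is a transversal of that kernel, and the
  composite has the kernel of \<open>g\<close> and the image of \<open>f\<close>.\<close>

lemma compose_mem_transformation_monoid:
  assumes compatible: "J_minimal_compatible \<B> \<I>"
    and f: "f \<in> carrier (transformation_monoid \<Omega> \<B> \<I>)"
    and g: "g \<in> carrier (transformation_monoid \<Omega> \<B> \<I>)"
  shows "compose \<Omega> f g \<in> carrier (transformation_monoid \<Omega> \<B> \<I>)"
proof -
  let ?M = "transformation_monoid \<Omega> \<B> \<I>"
  have const: "(\<lambda>x\<in>\<Omega>. c) \<in> carrier ?M" if "c \<in> \<Omega>" for c
    using that by (auto simp: transformation_monoid_def)
  have fE: "f \<in> \<Omega> \<rightarrow>\<^sub>E \<Omega>" and gE: "g \<in> \<Omega> \<rightarrow>\<^sub>E \<Omega>"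
    using f g carrier_transformation_monoid_subset by blast+
  consider (id) "f = (\<lambda>x\<in>\<Omega>. x) \<or> g = (\<lambda>x\<in>\<Omega>. x)"
    | (const_left) c where "c \<in> \<Omega>" "f = (\<lambda>x\<in>\<Omega>. c)"
    | (const_right) c where "c \<in> \<Omega>" "g = (\<lambda>x\<in>\<Omega>. c)"
    | (rank) "kernel_partition \<Omega> f \<in> \<B>" "f ` \<Omega> \<in> \<I>" "kernel_partition \<Omega> g \<in> \<B>" "g ` \<Omega> \<in> \<I>"
    using f g by (auto simp: transformation_monoid_def)
  then show ?thesis
  proof cases
    case id
    then have "compose \<Omega> f g = g \<or> compose \<Omega> f g = f"
      using fE gE by (auto simp: compose_def fun_eq_iff PiE_def extensional_def)
    with f g show ?thesis by auto
  next
    case (const_left c)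
    then have "compose \<Omega> f g = (\<lambda>x\<in>\<Omega>. c)"
      using gE by (auto simp: compose_def fun_eq_iff)
    with const[OF \<open>c \<in> \<Omega>\<close>] show ?thesis by simp
  next
    case (const_right c)
    then have "compose \<Omega> f g = (\<lambda>x\<in>\<Omega>. f c)"
      by (auto simp: compose_def fun_eq_iff)
    with const[of "f c"] fE const_right show ?thesis by auto
  next
    case rank
    have "(\<exists>b\<in>kernel_partition \<Omega> f. g ` \<Omega> \<subseteq> b) \<or>
        (\<forall>b\<in>kernel_partition \<Omega> f. \<exists>!x. x \<in> g ` \<Omega> \<inter> b)"
      using bspec[OF bspec[OF compatible[unfolded J_minimal_compatible_def] rank(1)] rank(4)] .
    then show ?thesis
    proof
      assume "\<exists>b\<in>kernel_partition \<Omega> f. g ` \<Omega> \<subseteq> b"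
      then obtain w where "w \<in> f ` \<Omega>" and "\<forall>x\<in>\<Omega>. f (g x) = w"
        by (auto simp: kernel_partition_def)
      then have "compose \<Omega> f g = (\<lambda>x\<in>\<Omega>. w)" and "w \<in> \<Omega>"
        using fE by (auto simp: compose_def fun_eq_iff)
      then show ?thesis using const by simp
    next
      assume transversal: "\<forall>b\<in>kernel_partition \<Omega> f. \<exists>!x. x \<in> g ` \<Omega> \<inter> b"
      \<comment> \<open>Uniqueness makes \<open>f\<close> injective on the image of
        \<open>g\<close>, which preserves the kernel of \<open>g\<close>; existence makes
        \<open>f\<close> map that image onto all of its own image.\<close>
      have unique: "\<exists>!x. x \<in> g ` \<Omega> \<inter> {x \<in> \<Omega>. f x = f z}" if "z \<in> \<Omega>" for z
        using that by (intro bspec[OF transversal]) (simp add: kernel_partition_def)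
      have g_image: "g ` \<Omega> \<subseteq> \<Omega>" using gE by auto
      have inj: "f (g x) = f (g y) \<longleftrightarrow> g x = g y" if "x \<in> \<Omega>" "y \<in> \<Omega>" for x y
      proof
        assume "f (g x) = f (g y)"
        then have "g x \<in> g ` \<Omega> \<inter> {z \<in> \<Omega>. f z = f (g x)}"
          and "g y \<in> g ` \<Omega> \<inter> {z \<in> \<Omega>. f z = f (g x)}"
          using that g_image by (simp_all add: image_subset_iff)
        moreover have "\<exists>!u. u \<in> g ` \<Omega> \<inter> {z \<in> \<Omega>. f z = f (g x)}"
          using that g_image by (intro unique) (simp add: image_subset_iff)
        ultimately show "g x = g y" by metis
      qed simp
      have "f ` \<Omega> \<subseteq> f ` g ` \<Omega>"
      proof
        fix w assume "w \<in> f ` \<Omega>"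
        then obtain z where "z \<in> \<Omega>" "w = f z" by auto
        from ex1_implies_ex[OF unique[OF \<open>z \<in> \<Omega>\<close>]]
        obtain u where "u \<in> g ` \<Omega>" "f u = f z" by blast
        with \<open>w = f z\<close> show "w \<in> f ` g ` \<Omega>" by (metis image_eqI)
      qed
      then have image: "compose \<Omega> f g ` \<Omega> = f ` \<Omega>"
        using g_image by (auto simp: compose_def image_image)
      have "kernel_partition \<Omega> (compose \<Omega> f g) = kernel_partition \<Omega> g"
        unfolding kernel_partition_def image_image
        by (intro image_cong refl) (auto simp: compose_def inj)
      moreover have "compose \<Omega> f g \<in> \<Omega> \<rightarrow>\<^sub>E \<Omega>"
        using fE gE by (auto simp: compose_def)
      ultimately show ?thesis
        using rank image by (simp add: transformation_monoid_def)
    qed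
  qed
qed

lemma monoid_transformation_monoid:
  assumes "J_minimal_compatible \<B> \<I>"
  shows "monoid (transformation_monoid \<Omega> \<B> \<I>)"
proof -
  let ?M = "transformation_monoid \<Omega> \<B> \<I>"
  have mult: "mult ?M = compose \<Omega>" and one: "one ?M = (\<lambda>x\<in>\<Omega>. x)"
    by (simp_all add: transformation_monoid_def fun_eq_iff)
  have maps: "f \<in> \<Omega> \<rightarrow>\<^sub>E \<Omega>" if "f \<in> carrier ?M" for f
    using that carrier_transformation_monoid_subset by blast
  show ?thesis
  proof (rule monoidI; unfold mult one)
    show "(\<lambda>x\<in>\<Omega>. x) \<in> carrier ?M"
      by (simp add: transformation_monoid_def)
  next
    fix f g h assume "f \<in> carrier ?M" "g \<in> carrier ?M" "h \<in> carrier ?M"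
    then show "compose \<Omega> (compose \<Omega> f g) h = compose \<Omega> f (compose \<Omega> g h)"
      using maps[of h] by (auto simp: compose_def fun_eq_iff)
  next
    fix f assume "f \<in> carrier ?M"
    then show "compose \<Omega> (\<lambda>x\<in>\<Omega>. x) f = f" "compose \<Omega> f (\<lambda>x\<in>\<Omega>. x) = f"
      using maps[of f] by (auto simp: compose_def fun_eq_iff PiE_def extensional_def)
  qed (rule compose_mem_transformation_monoid[OF assms])
qed

text \<open>Supplies a monoid element for any chosen bijection from blocks to image points.
  Injectivity of \<open>g\<close> makes the fibres of \<open>f\<close> exactly the blocks, and since
  no block is empty, every point of \<open>I\<close> is attained.\<close>

lemma block_map_mem_transformation_monoid:
  assumes \<pi>: "partition_on \<Omega> \<pi>" "\<pi> \<in> \<B>" and I: "I \<in> \<I>" "I \<subseteq> \<Omega>"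
    and g: "bij_betw g \<pi> I"
  obtains f where "f \<in> carrier (transformation_monoid \<Omega> \<B> \<I>)"
    and "\<And>b x. b \<in> \<pi> \<Longrightarrow> x \<in> b \<Longrightarrow> f x = g b"
proof -
  define f where "f = (\<lambda>x\<in>\<Omega>. g (THE b. b \<in> \<pi> \<and> x \<in> b))"
  have sub: "b \<subseteq> \<Omega>" if "b \<in> \<pi>" for b
    using that \<pi>(1) by (auto simp: partition_on_def)
  have cover: "\<exists>b\<in>\<pi>. x \<in> b" if "x \<in> \<Omega>" for x
    using that \<pi>(1) by (auto simp: partition_on_def)
  have ne: "\<exists>x. x \<in> b" if "b \<in> \<pi>" for b
    using partition_onD3[OF \<pi>(1)] that by (metis all_not_in_conv)
  have uniq: "b = c" if "b \<in> \<pi>" "c \<in> \<pi>" "x \<in> b" "x \<in> c" for b c x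
    using that \<pi>(1) by (auto simp: partition_on_def disjoint_def)
  have f: "f x = g b" if "b \<in> \<pi>" "x \<in> b" for b x
  proof -
    have "(THE b. b \<in> \<pi> \<and> x \<in> b) = b"
      using that uniq by (intro the_equality) auto
    with that sub show ?thesis by (auto simp: f_def)
  qed
  have gI: "g ` \<pi> = I" and inj: "inj_on g \<pi>"
    using g by (auto simp: bij_betw_def)
  have image: "f ` \<Omega> = g ` \<pi>"
  proof
    show "f ` \<Omega> \<subseteq> g ` \<pi>" using cover f by fastforce
    show "g ` \<pi> \<subseteq> f ` \<Omega>"
    proof
      fix y assume "y \<in> g ` \<pi>"
      then obtain b x where "b \<in> \<pi>" "y = g b" "x \<in> b" using ne by blast
      then show "y \<in> f ` \<Omega>" using f sub by (intro image_eqI[of _ _ x]) auto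
    qed
  qed
  have "{x \<in> \<Omega>. f x = g b} = b" if "b \<in> \<pi>" for b
  proof
    show "{x \<in> \<Omega>. f x = g b} \<subseteq> b"
      using that cover f inj by (fastforce dest: inj_onD)
    show "b \<subseteq> {x \<in> \<Omega>. f x = g b}"
      using that f sub by auto
  qed
  then have "kernel_partition \<Omega> f = \<pi>"
    unfolding kernel_partition_def image image_image by simp
  moreover have "f \<in> \<Omega> \<rightarrow>\<^sub>E \<Omega>"
    using image gI I by (auto simp: f_def)
  ultimately have "f \<in> carrier (transformation_monoid \<Omega> \<B> \<I>)"
    using \<pi> I image gI by (simp add: transformation_monoid_def)
  then show thesis using f by (rule that)
qed

section \<open>Differences of points in a nonzero submodule\<close>

lemma submodule_augmentationD:
  assumes fin: "finite \<Omega>" and carrier: "carrier G \<subseteq> \<Omega> \<rightarrow>\<^sub>E \<Omega>"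
    and N: "submodule N (monoid_algebra G) (augmentation_module \<Omega> G)"
  shows "N \<subseteq> augmentation \<Omega>"
    and "(\<lambda>x. 0) \<in> N"
    and "v \<in> N \<Longrightarrow> w \<in> N \<Longrightarrow> (\<lambda>x. v x + w x) \<in> N"
    and "f \<in> carrier G \<Longrightarrow> v \<in> N \<Longrightarrow> (\<lambda>y. c * (\<Sum>x\<in>\<Omega>. of_bool (f x = y) * v x)) \<in> N"
proof -
  interpret submodule N "monoid_algebra G" "augmentation_module \<Omega> G" by fact
  show "N \<subseteq> augmentation \<Omega>"
    using subset by (simp add: augmentation_module_def)
  \<comment> \<open>A \<open>submodule\<close> is in particular a subgroup of the additive group,
    written multiplicatively: \<open>one_closed\<close> speaks of zero and \<open>m_closed\<close>
    of addition.\<close>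
  show "(\<lambda>x. 0) \<in> N"
    using one_closed by (simp add: augmentation_module_def natural_module_def)
  show "(\<lambda>x. v x + w x) \<in> N" if "v \<in> N" "w \<in> N"
    using m_closed[OF that] by (simp add: augmentation_module_def natural_module_def)
  show "(\<lambda>y. c * (\<Sum>x\<in>\<Omega>. of_bool (f x = y) * v x)) \<in> N" if f: "f \<in> carrier G" and v: "v \<in> N"
  proof -
    have finG: "finite (carrier G)"
      using carrier finite_PiE[OF fin fin] by (rule finite_subset)
    \<comment> \<open>The algebra element \<open>c\<close> times \<open>f\<close>; acting with it
      pushes \<open>v\<close> forward along \<open>f\<close> and scales the result.\<close>
    have "(\<lambda>m. if m = f then c else 0) \<in> carrier (monoid_algebra G)"
      using f by (auto simp: monoid_algebra_def)
    from smult_closed[OF this v] show ?thesis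
      unfolding augmentation_module_smult[OF fin] bilinear_extension_delta_left[OF finG f, abs_def] .
  qed
qed

text \<open>If all block sums were equal to the nonzero sum over \<open>b\<close>, the total would
  be that number times the positive number of blocks, hence nonzero.\<close>

lemma obtain_distinct_block_sums:
  assumes fin: "finite \<Omega>" and \<pi>: "partition_on \<Omega> \<pi>"
    and v: "(\<Sum>x\<in>\<Omega>. v x) = (0 :: complex)"
    and b: "b \<in> \<pi>" "sum v b \<noteq> 0"
  obtains c d where "c \<in> \<pi>" "d \<in> \<pi>" "sum v c \<noteq> sum v d"
proof -
  have "\<exists>c\<in>\<pi>. sum v c \<noteq> sum v b"
  proof (rule ccontr)
    assume "\<not> ?thesis"
    then have "(\<Sum>c\<in>\<pi>. sum v c) = of_nat (card \<pi>) * sum v b" by simp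
    moreover have "(\<Sum>c\<in>\<pi>. sum v c) = 0"
      using sum.partition[OF fin \<pi>] v by metis
    ultimately show False
      using b finite_elements[OF fin \<pi>] by auto
  qed
  then show thesis using b that by blast
qed

text \<open>Pushing \<open>v\<close> forward along a map that is constant on blocks depends on
  \<open>v\<close> only through its block sums.\<close>

lemma sum_block_map:
  fixes v :: "'a \<Rightarrow> complex"
  assumes fin: "finite \<Omega>" and \<pi>: "partition_on \<Omega> \<pi>"
    and f: "\<And>b x. b \<in> \<pi> \<Longrightarrow> x \<in> b \<Longrightarrow> f x = g b"
  shows "(\<Sum>x\<in>\<Omega>. of_bool (f x = y) * v x) = (\<Sum>b\<in>\<pi>. of_bool (g b = y) * sum v b)"
proof -
  have "(\<Sum>x\<in>\<Omega>. of_bool (f x = y) * v x) = (\<Sum>b\<in>\<pi>. \<Sum>x\<in>b. of_bool (f x = y) * v x)"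
    by (rule sum.partition[OF fin \<pi>])
  also have "\<dots> = (\<Sum>b\<in>\<pi>. \<Sum>x\<in>b. of_bool (g b = y) * v x)"
    by (intro sum.cong refl) (simp add: f)
  finally show ?thesis by (simp add: sum_distrib_left)
qed

text \<open>Applied to one \<open>h\<close> with \<open>i\<close> and \<open>j\<close> in either
  order, this yields two bijections that differ only at \<open>a\<close> and
  \<open>b\<close>.\<close>

lemma bij_betw_fun_upd2:
  assumes h: "bij_betw h (A - {a, b}) (B - {i, j})"
    and "a \<in> A" "b \<in> A" "i \<in> B" "j \<in> B" "a \<noteq> b" "i \<noteq> j"
  shows "bij_betw (h(a := i, b := j)) A B"
proof -
  have "bij_betw (h(a := i, b := j)) (A - {a, b}) (B - {i, j})
      \<longleftrightarrow> bij_betw h (A - {a, b}) (B - {i, j})"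
    by (rule bij_betw_cong) simp
  with h have "bij_betw (h(a := i, b := j)) (A - {a, b}) (B - {i, j})" by blast
  moreover have "bij_betw (h(a := i, b := j)) {a, b} {i, j}"
    using \<open>a \<noteq> b\<close> \<open>i \<noteq> j\<close> by (auto simp: bij_betw_def inj_on_def)
  ultimately have "bij_betw (h(a := i, b := j)) ((A - {a, b}) \<union> {a, b}) ((B - {i, j}) \<union> {i, j})"
    by (rule bij_betw_combine) auto
  moreover have "(A - {a, b}) \<union> {a, b} = A" "(B - {i, j}) \<union> {i, j} = B"
    using \<open>a \<in> A\<close> \<open>b \<in> A\<close> \<open>i \<in> B\<close> \<open>j \<in> B\<close> by auto
  ultimately show ?thesis by simp
qed

text \<open>Two maps with kernel \<open>\<pi>\<close> and image \<open>I\<close> that differ by exchanging \<open>i\<close> and \<open>j\<close> send \<open>v\<close>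
  to vectors whose difference is a multiple of \<open>i - j\<close>; the factor is nonzero if the preimages of
  \<open>i\<close> and \<open>j\<close> are blocks on which \<open>v\<close> has different sums.\<close>

lemma difference_mem_submodule:
  assumes fin: "finite \<Omega>"
    and N: "submodule N (monoid_algebra (transformation_monoid \<Omega> \<B> \<I>))
              (augmentation_module \<Omega> (transformation_monoid \<Omega> \<B> \<I>))"
    and v: "v \<in> N" and \<pi>: "\<pi> \<in> \<B>" "partition_on \<Omega> \<pi>" and b: "b \<in> \<pi>" "sum v b \<noteq> 0"
    and I: "I \<in> \<I>" "I \<subseteq> \<Omega>" "card I = card \<pi>" and ij: "i \<in> I" "j \<in> I"
  shows "(\<lambda>y. of_bool (y = i) - of_bool (y = j)) \<in> N"
proof (cases "i = j")
  case True
  with submodule_augmentationD(2)[OF fin carrier_transformation_monoid_subset N]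
  show ?thesis by simp
next
  case False
  note D = submodule_augmentationD[OF fin carrier_transformation_monoid_subset N]
  have "(\<Sum>x\<in>\<Omega>. v x) = 0"
    using D(1) v by (auto simp: augmentation_def)
  then obtain c d where cd: "c \<in> \<pi>" "d \<in> \<pi>" "sum v c \<noteq> sum v d"
    using obtain_distinct_block_sums[OF fin \<pi>(2) _ b] by blast
  then have "c \<noteq> d" by auto
  have fin\<pi>: "finite \<pi>" and finI: "finite I"
    using finite_elements[OF fin \<pi>(2)] finite_subset[OF I(2) fin] by auto
  \<comment> \<open>There are as many blocks as points of \<open>I\<close>, so the blocks other than
    \<open>c\<close> and \<open>d\<close> can be matched with the points other than \<open>i\<close>
    and \<open>j\<close>. Both maps below share this matching.\<close>
  have "card (\<pi> - {c, d}) = card (I - {i, j})"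
    using cd ij \<open>c \<noteq> d\<close> False I(3) by (simp add: card_Diff_subset)
  then obtain h where h: "bij_betw h (\<pi> - {c, d}) (I - {i, j})"
    using finite_same_card_bij fin\<pi> finI by blast
  have h': "bij_betw h (\<pi> - {c, d}) (I - {j, i})"
    using h by (simp add: insert_commute)
  let ?g = "h(c := i, d := j)" and ?g' = "h(c := j, d := i)"
  have g: "bij_betw ?g \<pi> I"
    by (rule bij_betw_fun_upd2[OF h]) (use cd ij \<open>c \<noteq> d\<close> False in auto)
  have g': "bij_betw ?g' \<pi> I"
    by (rule bij_betw_fun_upd2[OF h']) (use cd ij \<open>c \<noteq> d\<close> False in auto)
  obtain f where f: "f \<in> carrier (transformation_monoid \<Omega> \<B> \<I>)"
    and fg: "\<And>b x. b \<in> \<pi> \<Longrightarrow> x \<in> b \<Longrightarrow> f x = ?g b"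
    using block_map_mem_transformation_monoid[OF \<pi>(2,1) I(1,2) g] by metis
  obtain f' where f': "f' \<in> carrier (transformation_monoid \<Omega> \<B> \<I>)"
    and fg': "\<And>b x. b \<in> \<pi> \<Longrightarrow> x \<in> b \<Longrightarrow> f' x = ?g' b"
    using block_map_mem_transformation_monoid[OF \<pi>(2,1) I(1,2) g'] by metis
  define r where "r = 1 / (sum v c - sum v d)"
  have "(\<lambda>y. r * (\<Sum>x\<in>\<Omega>. of_bool (f x = y) * v x)
      + (- r) * (\<Sum>x\<in>\<Omega>. of_bool (f' x = y) * v x)) \<in> N"
    by (intro D(3) D(4) f f' v)
  moreover have "r * (\<Sum>x\<in>\<Omega>. of_bool (f x = y) * v x)
      + (- r) * (\<Sum>x\<in>\<Omega>. of_bool (f' x = y) * v x) = of_bool (y = i) - of_bool (y = j)" for y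
  proof -
    have "(\<Sum>x\<in>\<Omega>. of_bool (f x = y) * v x) - (\<Sum>x\<in>\<Omega>. of_bool (f' x = y) * v x)
        = (\<Sum>b\<in>\<pi>. of_bool (?g b = y) * sum v b) - (\<Sum>b\<in>\<pi>. of_bool (?g' b = y) * sum v b)"
      using sum_block_map[where f = f and g = ?g, OF fin \<pi>(2) fg]
        sum_block_map[where f = f' and g = ?g', OF fin \<pi>(2) fg'] by presburger
    also have "\<dots> = (\<Sum>b\<in>\<pi>. (of_bool (?g b = y) - of_bool (?g' b = y)) * sum v b)"
      unfolding sum_subtractf[symmetric] left_diff_distrib ..
    \<comment> \<open>Away from \<open>c\<close> and \<open>d\<close> both bijections equal
      \<open>h\<close>, so those terms cancel.\<close>
    also have "\<dots> = (\<Sum>b\<in>{c, d}. (of_bool (?g b = y) - of_bool (?g' b = y)) * sum v b)"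
      by (rule sum.mono_neutral_right) (use fin\<pi> cd in auto)
    also have "\<dots> = (of_bool (y = i) - of_bool (y = j)) * (sum v c - sum v d)"
      using \<open>c \<noteq> d\<close> by (simp add: algebra_simps of_bool_def)
    finally have eq: "(\<Sum>x\<in>\<Omega>. of_bool (f x = y) * v x) - (\<Sum>x\<in>\<Omega>. of_bool (f' x = y) * v x)
        = (of_bool (y = i) - of_bool (y = j)) * (sum v c - sum v d)" .
    have "r * (\<Sum>x\<in>\<Omega>. of_bool (f x = y) * v x) + (- r) * (\<Sum>x\<in>\<Omega>. of_bool (f' x = y) * v x)
        = r * ((\<Sum>x\<in>\<Omega>. of_bool (f x = y) * v x) - (\<Sum>x\<in>\<Omega>. of_bool (f' x = y) * v x))"
      by (simp only: distrib_left mult_minus_left mult_minus_right diff_conv_add_uminus)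
    also have "\<dots> = of_bool (y = i) - of_bool (y = j)"
      unfolding eq r_def using cd(3) by simp
    finally show ?thesis .
  qed
  ultimately show ?thesis by simp
qed

section \<open>Simplicity from connectedness and separation\<close>

text \<open>The subtracted terms add up to the coefficient sum of \<open>v\<close> times
  \<open>z\<close>, which is zero. Hence the differences to one base point \<open>z\<close> span the
  augmentation.\<close>

lemma augmentation_eq_sum_differences:
  assumes "finite \<Omega>" "z \<in> \<Omega>" "v \<in> augmentation \<Omega>"
  shows "v = (\<lambda>y. \<Sum>x\<in>\<Omega>. v x * (of_bool (y = x) - of_bool (y = z)))"
proof
  fix y
  have "(\<Sum>x\<in>\<Omega>. v x * (of_bool (y = x) - of_bool (y = z)))
      = (\<Sum>x\<in>\<Omega>. if y = x then v x else 0) - (\<Sum>x\<in>\<Omega>. v x) * of_bool (y = z)"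
    unfolding right_diff_distrib sum_subtractf sum_distrib_right
    by (intro arg_cong2[where f = minus] sum.cong refl) auto
  also have "\<dots> = v y"
    using assms by (auto simp: augmentation_def)
  finally show "v y = (\<Sum>x\<in>\<Omega>. v x * (of_bool (y = x) - of_bool (y = z)))" ..
qed

text \<open>Reduces simplicity to two combinatorial facts: \<open>connected\<close> spreads
  differences from single lines to all of \<Omega>, and \<open>separating\<close> provides the
  nonzero block sum from which the first differences arise.\<close>

lemma simple_augmentation_module:
  assumes fin: "finite \<Omega>" and card: "card \<Omega> \<ge> 2"
    and \<B>: "\<And>\<pi>. \<pi> \<in> \<B> \<Longrightarrow> partition_on \<Omega> \<pi> \<and> card \<pi> = r"
    and \<I>: "\<And>I. I \<in> \<I> \<Longrightarrow> I \<subseteq> \<Omega> \<and> card I = r"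
    and compatible: "J_minimal_compatible \<B> \<I>"
    and connected: "\<And>x y. x \<in> \<Omega> \<Longrightarrow> y \<in> \<Omega> \<Longrightarrow> (x, y) \<in> {(x, y). \<exists>I\<in>\<I>. x \<in> I \<and> y \<in> I}\<^sup>*"
    and separating: "\<And>v. v \<in> augmentation \<Omega> \<Longrightarrow> (\<And>\<pi> b. \<pi> \<in> \<B> \<Longrightarrow> b \<in> \<pi> \<Longrightarrow> sum v b = 0)
                       \<Longrightarrow> v = (\<lambda>x. 0)"
  shows "simple_module (monoid_algebra (transformation_monoid \<Omega> \<B> \<I>))
           (augmentation_module \<Omega> (transformation_monoid \<Omega> \<B> \<I>))"
proof -
  let ?M = "transformation_monoid \<Omega> \<B> \<I>" and ?e = "\<lambda>i j y. of_bool (y = i) - of_bool (y = j)"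
  have zero: "\<zero>\<^bsub>augmentation_module \<Omega> ?M\<^esub> = (\<lambda>x. 0)"
    and carrier: "carrier (augmentation_module \<Omega> ?M) = augmentation \<Omega>"
    by (simp_all add: augmentation_module_def natural_module_def)
  have "left_module (monoid_algebra ?M) (augmentation_module \<Omega> ?M)"
    by (rule left_module_augmentation_module[OF fin monoid_transformation_monoid[OF compatible]
          carrier_transformation_monoid_subset]) (simp_all add: transformation_monoid_def)
  moreover have "augmentation \<Omega> \<noteq> {\<lambda>x. 0}"
  proof -
    \<comment> \<open>The difference of two distinct points witnesses that the augmentation is not
      zero.\<close>
    obtain x y where xy: "x \<in> \<Omega>" "y \<in> \<Omega>" "x \<noteq> y"
      using card card_le_Suc0_iff_eq[OF fin] by fastforce
    have "(\<Sum>z\<in>\<Omega>. of_bool (z = w)) = (1 :: complex)" if "w \<in> \<Omega>" for w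
      using fin that unfolding of_bool_def by simp
    with xy have "?e x y \<in> augmentation \<Omega>"
      unfolding augmentation_def mem_Collect_eq sum_subtractf by auto
    moreover have "?e x y \<noteq> (\<lambda>x. 0 :: complex)"
      using xy by (auto dest: fun_cong[of _ _ x])
    ultimately show ?thesis by blast
  qed
  moreover have "N = {\<lambda>x. 0} \<or> N = augmentation \<Omega>"
    if N: "submodule N (monoid_algebra ?M) (augmentation_module \<Omega> ?M)" for N
  proof (cases "N = {\<lambda>x. 0}")
    case False
    note D = submodule_augmentationD[OF fin carrier_transformation_monoid_subset N]
    from False D(2) obtain v where v: "v \<in> N" "v \<noteq> (\<lambda>x. 0)" by blast
    then obtain \<pi> b where \<pi>: "\<pi> \<in> \<B>" "b \<in> \<pi>" "sum v b \<noteq> 0"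
      using separating[of v] D(1) by blast
    have line: "?e x y \<in> N" if "I \<in> \<I>" "x \<in> I" "y \<in> I" for I x y
      using difference_mem_submodule[OF fin N v(1) \<pi>(1) _ \<pi>(2,3)] \<B>[OF \<pi>(1)] \<I>[OF that(1)] that
      by simp
    have diff: "?e x y \<in> N" if x: "x \<in> \<Omega>" and y: "y \<in> \<Omega>" for x y
      using connected[OF x y]
    proof (induction rule: rtrancl_induct)
      case base
      show ?case using D(2) by simp
    next
      case (step y z)
      then obtain I where "I \<in> \<I>" "y \<in> I" "z \<in> I" by auto
      \<comment> \<open>Differences telescope along a path: \<open>?e x y\<close> plus
        \<open>?e y z\<close> is \<open>?e x z\<close>.\<close>
      from D(3)[OF step.IH line[OF this]] show ?case by simp
    qed
    \<comment> \<open>Complex scalars act through the algebra, as multiples of the identity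
      map.\<close>
    have scale: "(\<lambda>y. c * w y) \<in> N" if w: "w \<in> N" for c w
    proof -
      have "(\<lambda>x\<in>\<Omega>. x) \<in> carrier ?M" by (simp add: transformation_monoid_def)
      from D(4)[OF this w]
      have "(\<lambda>y. c * (\<Sum>x\<in>\<Omega>. of_bool ((\<lambda>x\<in>\<Omega>. x) x = y) * w x)) \<in> N" .
      moreover have "(\<Sum>x\<in>\<Omega>. of_bool ((\<lambda>x\<in>\<Omega>. x) x = y) * w x) = w y" for y
      proof -
        have "(\<Sum>x\<in>\<Omega>. of_bool ((\<lambda>x\<in>\<Omega>. x) x = y) * w x) = (\<Sum>x\<in>\<Omega>. if x = y then w x else 0)"
          by (intro sum.cong) auto
        with fin D(1) w show ?thesis by (auto simp: augmentation_def)
      qed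
      ultimately show ?thesis by simp
    qed
    have sum: "(\<lambda>y. \<Sum>x\<in>X. u x y) \<in> N" if "finite X" "\<And>x. x \<in> X \<Longrightarrow> u x \<in> N"
      for X and u :: "'a \<Rightarrow> 'a \<Rightarrow> complex"
      using that
    proof (induction X)
      case empty
      show ?case using D(2) by simp
    next
      case (insert a X)
      then have "(\<lambda>y. u a y + (\<Sum>x\<in>X. u x y)) \<in> N"
        by (intro D(3)) simp_all
      with insert.hyps show ?case by simp
    qed
    obtain z where z: "z \<in> \<Omega>" using card by fastforce
    have "w \<in> N" if w: "w \<in> augmentation \<Omega>" for w
      by (subst augmentation_eq_sum_differences[OF fin z w]) (rule sum[OF fin scale[OF diff[OF _ z]]])
    then have "augmentation \<Omega> \<subseteq> N" ..
    with D(1) have "N = augmentation \<Omega>" by (rule equalityI)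
    then show ?thesis ..
  qed simp
  ultimately show ?thesis
    unfolding simple_module_def zero carrier by simp
qed

section \<open>Partitions compatible with the triangle\<close>

text \<open>Two points of \<open>I\<close> in one block rule out the transversal alternative, and
  disjointness of blocks identifies the block that contains \<open>I\<close> as
  \<open>b\<close>.\<close>

lemma subset_block:
  assumes "J_minimal_compatible \<B> \<I>" "partition_on \<Omega> \<pi>" "\<pi> \<in> \<B>" "I \<in> \<I>" "b \<in> \<pi>"
    and xy: "x \<in> I \<inter> b" "y \<in> I \<inter> b" "x \<noteq> y"
  shows "I \<subseteq> b"
proof -
  have "(\<exists>c\<in>\<pi>. I \<subseteq> c) \<or> (\<forall>c\<in>\<pi>. \<exists>!x. x \<in> I \<inter> c)"
    using bspec[OF bspec[OF assms(1)[unfolded J_minimal_compatible_def] assms(3)] assms(4)] .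
  then show ?thesis
  proof
    assume "\<exists>c\<in>\<pi>. I \<subseteq> c"
    then obtain c where c: "c \<in> \<pi>" "I \<subseteq> c" ..
    then have "c = b"
      using partition_onD2[OF assms(2)] assms(5) xy by (auto simp: disjoint_def)
    with c show ?thesis by simp
  next
    assume "\<forall>c\<in>\<pi>. \<exists>!x. x \<in> I \<inter> c"
    then have "\<exists>!x. x \<in> I \<inter> b" using assms(5) ..
    with xy show ?thesis by metis
  qed
qed

text \<open>Points of \<open>I\<close> in two different blocks rule out containment in one block, so
  \<open>I\<close> is a transversal and reaches the third block \<open>d\<close> too.\<close>

lemma meets_block:
  assumes "J_minimal_compatible \<B> \<I>" "partition_on \<Omega> \<pi>" "\<pi> \<in> \<B>" "I \<in> \<I>" "b \<in> \<pi>" "c \<in> \<pi>" "d \<in> \<pi>"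
    and xy: "x \<in> I \<inter> b" "y \<in> I \<inter> c" "b \<noteq> c"
  shows "\<exists>z. z \<in> I \<inter> d"
proof -
  have "(\<exists>c\<in>\<pi>. I \<subseteq> c) \<or> (\<forall>c\<in>\<pi>. \<exists>!x. x \<in> I \<inter> c)"
    using bspec[OF bspec[OF assms(1)[unfolded J_minimal_compatible_def] assms(3)] assms(4)] .
  then show ?thesis
  proof
    assume "\<exists>c\<in>\<pi>. I \<subseteq> c"
    then obtain e where e: "e \<in> \<pi>" "I \<subseteq> e" ..
    then have "e = b" "e = c"
      using partition_onD2[OF assms(2)] assms(5,6) xy by (auto simp: disjoint_def)
    with xy show ?thesis by simp
  next
    assume "\<forall>c\<in>\<pi>. \<exists>!x. x \<in> I \<inter> c"
    then show ?thesis using assms(7) by (meson ex1_implies_ex)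
  qed
qed

text \<open>A point of \<open>A\<close> lies in \<open>X\<close>, \<open>Y\<close> or
  \<open>Z\<close>, and the last two are inside sets disjoint from \<open>A\<close>; the same holds
  for \<open>B\<close> and \<open>C\<close>. This turns known members of the blocks into the exact
  blocks.\<close>

lemma disjoint_cover_unique:
  assumes "A \<inter> B = {}" "A \<inter> C = {}" "B \<inter> C = {}" "A \<union> B \<union> C = X \<union> Y \<union> Z"
    and "X \<subseteq> A" "Y \<subseteq> B" "Z \<subseteq> C"
  shows "A = X \<and> B = Y \<and> C = Z"
  using assms by blast

text \<open>The side through \<open>a1\<close> and \<open>a3\<close> fills out in \<open>b\<close>,
  and the opposite vertex \<open>a5\<close> lies elsewhere. The other two sides then join different
  blocks, so they are transversals and their midpoints fall into the third block.\<close>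

lemma partition_two_vertices_in_block:
  assumes dist: "distinct [a1, a2, a3, a4, a5, a6]"
    and \<Omega>: "\<Omega> = {a1, a2, a3, a4, a5, a6}"
    and \<pi>: "partition_on \<Omega> \<pi>" "card \<pi> = 3" "\<pi> \<in> \<B>"
    and compatible: "J_minimal_compatible \<B> \<I>"
    and \<I>: "{a1, a2, a3} \<in> \<I>" "{a3, a4, a5} \<in> \<I>" "{a5, a6, a1} \<in> \<I>"
    and b: "b \<in> \<pi>" "a1 \<in> b" "a3 \<in> b"
  shows "\<pi> = {{a1, a2, a3}, {a5}, {a4, a6}}"
proof -
  note sub = subset_block[OF compatible \<pi>(1,3)]
  note meets = meets_block[OF compatible \<pi>(1,3)]
  have cover: "\<Union>\<pi> = \<Omega>" using partition_onD1[OF \<pi>(1)] ..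
  have disj: "x = y" if "x \<in> \<pi>" "y \<in> \<pi>" "z \<in> x" "z \<in> y" for x y z
    using partition_onD2[OF \<pi>(1)] that by (auto simp: disjoint_def)
  have b123: "{a1, a2, a3} \<subseteq> b"
    by (rule sub[OF \<I>(1) b(1), of a1 a3]) (use b dist in auto)
  \<comment> \<open>With all three vertices in \<open>b\<close>, each side would lie in
    \<open>b\<close>, leaving a single block instead of three.\<close>
  have "a5 \<notin> b"
  proof
    assume "a5 \<in> b"
    have "{a3, a4, a5} \<subseteq> b"
      by (rule sub[OF \<I>(2) b(1), of a3 a5]) (use b dist \<open>a5 \<in> b\<close> in auto)
    moreover have "{a5, a6, a1} \<subseteq> b"
      by (rule sub[OF \<I>(3) b(1), of a5 a1]) (use b dist \<open>a5 \<in> b\<close> in auto)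
    ultimately have "\<Omega> \<subseteq> b" using b123 \<Omega> by auto
    then have "c = b" if c: "c \<in> \<pi>" for c
    proof -
      obtain z where "z \<in> c" using c partition_onD3[OF \<pi>(1)] by (cases "c = {}") auto
      moreover from this have "z \<in> b" using c cover \<open>\<Omega> \<subseteq> b\<close> by auto
      ultimately show ?thesis using disj[OF c b(1)] by simp
    qed
    with b(1) have "\<pi> = {b}" by blast
    with \<pi>(2) show False by simp
  qed
  have "a5 \<in> \<Union>\<pi>" using cover \<Omega> by simp
  then obtain c where c: "c \<in> \<pi>" "a5 \<in> c" by blast
  with \<open>a5 \<notin> b\<close> have "b \<noteq> c" by auto
  have "card (\<pi> - {b, c}) = 1"
    using \<pi>(2) b(1) c(1) \<open>b \<noteq> c\<close> by (simp add: card_Diff_subset)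
  then obtain d where "\<pi> - {b, c} = {d}" by (auto simp: card_1_singleton_iff)
  then have \<pi>_eq: "\<pi> = {b, c, d}" and d: "d \<in> \<pi>" "d \<noteq> b" "d \<noteq> c"
    using b(1) c(1) by auto
  \<comment> \<open>The ends of this side lie in \<open>b\<close> and \<open>c\<close>, so its point
    in \<open>d\<close> can only be the midpoint \<open>a4\<close>.\<close>
  obtain z where z: "z \<in> {a3, a4, a5} \<inter> d"
    using meets[OF \<I>(2) b(1) c(1) d(1), of a3 a5] b c \<open>b \<noteq> c\<close> by auto
  then have "a4 \<in> d" using disj[OF d(1) b(1), of a3] disj[OF d(1) c(1), of a5] d b c by auto
  obtain z where z: "z \<in> {a5, a6, a1} \<inter> d"
    using meets[OF \<I>(3) c(1) b(1) d(1), of a5 a1] b c \<open>b \<noteq> c\<close> by auto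
  then have "a6 \<in> d" using disj[OF d(1) b(1), of a1] disj[OF d(1) c(1), of a5] d b c by auto
  have un: "b \<union> c \<union> d = {a1, a2, a3, a4, a5, a6}"
    using cover \<Omega> \<pi>_eq by auto
  have "b \<inter> c = {}" "b \<inter> d = {}" "c \<inter> d = {}"
    using disj b(1) c(1) d \<open>b \<noteq> c\<close> by auto
  then have "b = {a1, a2, a3} \<and> c = {a5} \<and> d = {a4, a6}"
    by (rule disjoint_cover_unique) (use un b123 c(2) \<open>a4 \<in> d\<close> \<open>a6 \<in> d\<close> in auto)
  with \<pi>_eq show ?thesis by simp
qed

text \<open>Every side has its ends in different blocks, hence is a transversal, and its midpoint
  must join the block of the opposite vertex.\<close>

lemma partition_vertices_in_distinct_blocks:
  assumes \<Omega>: "\<Omega> = {a1, a2, a3, a4, a5, a6}"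
    and \<pi>: "partition_on \<Omega> \<pi>" "card \<pi> = 3" "\<pi> \<in> \<B>"
    and compatible: "J_minimal_compatible \<B> \<I>"
    and \<I>: "{a1, a2, a3} \<in> \<I>" "{a3, a4, a5} \<in> \<I>" "{a5, a6, a1} \<in> \<I>"
    and blocks: "b \<in> \<pi>" "a1 \<in> b" "c \<in> \<pi>" "a3 \<in> c" "d \<in> \<pi>" "a5 \<in> d" "b \<noteq> c" "c \<noteq> d" "d \<noteq> b"
  shows "\<pi> = {{a1, a4}, {a3, a6}, {a2, a5}}"
proof -
  note meets = meets_block[OF compatible \<pi>(1,3)]
  have cover: "\<Union>\<pi> = \<Omega>" using partition_onD1[OF \<pi>(1)] ..
  have disj: "x \<inter> y = {}" if "x \<in> \<pi>" "y \<in> \<pi>" "x \<noteq> y" for x y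
    using partition_onD2[OF \<pi>(1)] that by (auto simp: disjoint_def)
  have \<pi>_eq: "\<pi> = {b, c, d}"
    using blocks \<pi>(2) by (intro card_seteq[symmetric]) (auto intro: card_ge_0_finite)
  have empty: "b \<inter> c = {}" "b \<inter> d = {}" "c \<inter> d = {}"
    using disj blocks by auto
  obtain z where "z \<in> {a1, a2, a3} \<inter> d"
    using meets[OF \<I>(1), of b c d a1 a3] blocks by auto
  then have "a2 \<in> d" using empty blocks by auto
  obtain z where "z \<in> {a3, a4, a5} \<inter> b"
    using meets[OF \<I>(2), of c d b a3 a5] blocks by auto
  then have "a4 \<in> b" using empty blocks by auto
  obtain z where "z \<in> {a5, a6, a1} \<inter> c"
    using meets[OF \<I>(3), of d b c a5 a1] blocks by auto
  then have "a6 \<in> c" using empty blocks by auto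
  have un: "b \<union> c \<union> d = {a1, a2, a3, a4, a5, a6}"
    using cover \<Omega> \<pi>_eq by auto
  from empty have "b = {a1, a4} \<and> c = {a3, a6} \<and> d = {a2, a5}"
    by (rule disjoint_cover_unique)
      (use un blocks \<open>a2 \<in> d\<close> \<open>a4 \<in> b\<close> \<open>a6 \<in> c\<close> in auto)
  with \<pi>_eq show ?thesis by simp
qed

text \<open>The cases are which two vertices, if any, share a block. The rotation by two positions
  permutes the sides, so one lemma handles all three sides.\<close>

lemma compatible_partition_cases:
  assumes dist: "distinct [a1, a2, a3, a4, a5, a6]"
    and \<Omega>: "\<Omega> = {a1, a2, a3, a4, a5, a6}"
    and \<pi>: "partition_on \<Omega> \<pi>" "card \<pi> = 3" "\<pi> \<in> \<B>"
    and compatible: "J_minimal_compatible \<B> \<I>"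
    and \<I>: "{a1, a2, a3} \<in> \<I>" "{a3, a4, a5} \<in> \<I>" "{a5, a6, a1} \<in> \<I>"
  shows "\<pi> \<in> {{{a1, a4}, {a3, a6}, {a2, a5}}, {{a1, a2, a3}, {a5}, {a4, a6}},
              {{a3, a4, a5}, {a1}, {a6, a2}}, {{a5, a6, a1}, {a3}, {a2, a4}}}"
proof -
  have cover: "\<Union>\<pi> = \<Omega>" using partition_onD1[OF \<pi>(1)] ..
  then have "a1 \<in> \<Union>\<pi>" "a3 \<in> \<Union>\<pi>" "a5 \<in> \<Union>\<pi>" using \<Omega> by auto
  then obtain b c d where bcd: "b \<in> \<pi>" "a1 \<in> b" "c \<in> \<pi>" "a3 \<in> c" "d \<in> \<pi>" "a5 \<in> d"
    by blast
  \<comment> \<open>The two nontrivial rotations of the hexagon that take vertices to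
    vertices.\<close>
  have \<Omega>': "\<Omega> = {a3, a4, a5, a6, a1, a2}" "\<Omega> = {a5, a6, a1, a2, a3, a4}"
    using \<Omega> by auto
  consider "b = c" | "c = d" | "d = b" | "b \<noteq> c" "c \<noteq> d" "d \<noteq> b" by blast
  then show ?thesis
  proof cases
    case 1
    then have "\<pi> = {{a1, a2, a3}, {a5}, {a4, a6}}"
      using bcd by (intro partition_two_vertices_in_block[OF dist \<Omega> \<pi> compatible \<I> bcd(1,2)]) simp
    then show ?thesis by (simp only: insert_iff simp_thms)
  next
    case 2
    have "distinct [a3, a4, a5, a6, a1, a2]" using dist by auto
    then have "\<pi> = {{a3, a4, a5}, {a1}, {a6, a2}}"
      by (rule partition_two_vertices_in_block[OF _ \<Omega>'(1) \<pi> compatible \<I>(2,3,1) bcd(3,4)])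
        (use 2 bcd in simp)
    then show ?thesis by (simp only: insert_iff simp_thms)
  next
    case 3
    have "distinct [a5, a6, a1, a2, a3, a4]" using dist by auto
    then have "\<pi> = {{a5, a6, a1}, {a3}, {a2, a4}}"
      by (rule partition_two_vertices_in_block[OF _ \<Omega>'(2) \<pi> compatible \<I>(3,1,2) bcd(5,6)])
        (use 3 bcd in simp)
    then show ?thesis by (simp only: insert_iff simp_thms)
  next
    case 4
    have "\<pi> = {{a1, a4}, {a3, a6}, {a2, a5}}"
      by (rule partition_vertices_in_distinct_blocks[OF \<Omega> \<pi> compatible \<I> bcd 4])
    then show ?thesis by (simp only: insert_iff simp_thms)
  qed
qed

section \<open>Separation by three of the four partitions\<close>

text \<open>If two of the four were missing, \<open>B\<close> would lie in the remaining pair and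
  have at most two elements. The six instances at the end run over all pairs.\<close>

lemma omit_at_most_one:
  assumes "B \<subseteq> {w, x, y, z}" "card B \<ge> 3"
  shows "x \<in> B \<and> y \<in> B \<and> z \<in> B \<or> w \<in> B \<and> y \<in> B \<and> z \<in> B
       \<or> w \<in> B \<and> x \<in> B \<and> z \<in> B \<or> w \<in> B \<and> x \<in> B \<and> y \<in> B"
proof -
  have "p \<in> B \<or> q \<in> B" if "{w, x, y, z} \<subseteq> {p, q, r, s}" for p q r s
  proof (rule ccontr)
    assume "\<not> ?thesis"
    then have "B \<subseteq> {r, s}" using assms(1) that by blast
    then have "card B \<le> card {r, s}" by (intro card_mono) auto
    also have "\<dots> \<le> 2" by (simp add: card_insert_if)
    finally show False using assms(2) by simp
  qed
  from this[of w x y z] this[of w y x z] this[of w z x y] this[of x y w z] this[of x z w y]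
    this[of y z w x]
  show ?thesis by auto
qed

text \<open>Each \<open>Pi\<close> stands for the presence of one partition. Without
  \<open>P1\<close>, all vertex coefficients vanish and each side equation kills its midpoint. With
  \<open>P1\<close>, two vertices vanish and so do the opposite midpoints; an equation for two
  midpoints then kills the third midpoint, and \<open>P1\<close> its opposite vertex.\<close>

lemma three_block_equations_zero:
  fixes v1 v2 v3 v4 v5 v6 :: complex
  assumes three: "P2 \<and> P3 \<and> P4 \<or> P1 \<and> P3 \<and> P4 \<or> P1 \<and> P2 \<and> P4 \<or> P1 \<and> P2 \<and> P3"
    and E1: "P1 \<Longrightarrow> v1 + v4 = 0 \<and> v3 + v6 = 0 \<and> v2 + v5 = 0"
    and E2: "P2 \<Longrightarrow> v1 + (v2 + v3) = 0 \<and> v5 = 0 \<and> v4 + v6 = 0"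
    and E3: "P3 \<Longrightarrow> v3 + (v4 + v5) = 0 \<and> v1 = 0 \<and> v6 + v2 = 0"
    and E4: "P4 \<Longrightarrow> v5 + (v6 + v1) = 0 \<and> v3 = 0 \<and> v2 + v4 = 0"
  shows "v1 = 0 \<and> v2 = 0 \<and> v3 = 0 \<and> v4 = 0 \<and> v5 = 0 \<and> v6 = 0"
  using three
proof (elim disjE conjE)
  assume P2 P3 P4
  \<comment> \<open>The equations are split into real and imaginary parts because
    \<open>linarith\<close> works over ordered fields.\<close>
  from E2[OF \<open>P2\<close>] E3[OF \<open>P3\<close>] E4[OF \<open>P4\<close>] show ?thesis
    unfolding complex_eq_iff plus_complex.sel zero_complex.sel
    by (elim conjE, intro conjI) linarith+
next
  assume P1 P3 P4
  from E1[OF \<open>P1\<close>] E3[OF \<open>P3\<close>] E4[OF \<open>P4\<close>] show ?thesis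
    unfolding complex_eq_iff plus_complex.sel zero_complex.sel
    by (elim conjE, intro conjI) linarith+
next
  assume P1 P2 P4
  from E1[OF \<open>P1\<close>] E2[OF \<open>P2\<close>] E4[OF \<open>P4\<close>] show ?thesis
    unfolding complex_eq_iff plus_complex.sel zero_complex.sel
    by (elim conjE, intro conjI) linarith+
next
  assume P1 P2 P3
  from E1[OF \<open>P1\<close>] E2[OF \<open>P2\<close>] E3[OF \<open>P3\<close>] show ?thesis
    unfolding complex_eq_iff plus_complex.sel zero_complex.sel
    by (elim conjE, intro conjI) linarith+
qed

section \<open>The six-point triangle\<close>

theorem theorem4p2:
  fixes \<omega>\<^sub>1 \<omega>\<^sub>2 \<omega>\<^sub>3 \<omega>\<^sub>4 \<omega>\<^sub>5 \<omega>\<^sub>6 :: 'a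
    and \<Omega> :: "'a set"
    and \<I> :: "'a set set"
    and \<B> :: "'a set set set"
    and M :: "('a \<Rightarrow> 'a) monoid"
  assumes "distinct [\<omega>\<^sub>1, \<omega>\<^sub>2, \<omega>\<^sub>3, \<omega>\<^sub>4, \<omega>\<^sub>5, \<omega>\<^sub>6]"
    and "\<Omega> = {\<omega>\<^sub>1, \<omega>\<^sub>2, \<omega>\<^sub>3, \<omega>\<^sub>4, \<omega>\<^sub>5, \<omega>\<^sub>6}"
    and "\<I> = {{\<omega>\<^sub>1, \<omega>\<^sub>2, \<omega>\<^sub>3}, {\<omega>\<^sub>3, \<omega>\<^sub>4, \<omega>\<^sub>5}, {\<omega>\<^sub>5, \<omega>\<^sub>6, \<omega>\<^sub>1}}"
    and "\<forall>\<pi>\<in>\<B>. partition_on \<Omega> \<pi> \<and> card \<pi> = 3"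
    and "J_minimal_compatible \<B> \<I>"
    and "card \<B> \<in> {3, 4}"
    and "M = transformation_monoid \<Omega> \<B> \<I>"
  shows "simple_module (monoid_algebra M) (augmentation_module \<Omega> M)"
  unfolding assms(7)
proof (rule simple_augmentation_module)
  show "finite \<Omega>" and "2 \<le> card \<Omega>"
    using assms(1,2) by auto
  show "partition_on \<Omega> \<pi> \<and> card \<pi> = 3" if "\<pi> \<in> \<B>" for \<pi>
    using assms(4) that by blast
  show "I \<subseteq> \<Omega> \<and> card I = 3" if "I \<in> \<I>" for I
    using that assms(1,2,3) by auto
  show "J_minimal_compatible \<B> \<I>" by fact
  let ?R = "{(x, y). \<exists>I\<in>\<I>. x \<in> I \<and> y \<in> I}"
  \<comment> \<open>Two sides contain \<open>\<omega>\<^sub>1\<close>; from the third it is reached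
    through \<open>\<omega>\<^sub>3\<close>. By symmetry of the relation, any two points are then
    joined through \<open>\<omega>\<^sub>1\<close>.\<close>
  have to_vertex: "(x, \<omega>\<^sub>1) \<in> ?R\<^sup>*" if x: "x \<in> \<Omega>" for x
  proof -
    have R: "(x, y) \<in> ?R\<^sup>*" if "I \<in> \<I>" "x \<in> I" "y \<in> I" for I x y
      using that by (intro r_into_rtrancl) auto
    have "{\<omega>\<^sub>1, \<omega>\<^sub>2, \<omega>\<^sub>3} \<in> \<I>" "{\<omega>\<^sub>3, \<omega>\<^sub>4, \<omega>\<^sub>5} \<in> \<I>" "{\<omega>\<^sub>5, \<omega>\<^sub>6, \<omega>\<^sub>1} \<in> \<I>"
      using assms(3) by auto
    note lines = this[THEN R]
    consider "x \<in> {\<omega>\<^sub>1, \<omega>\<^sub>2, \<omega>\<^sub>3}" | "x \<in> {\<omega>\<^sub>3, \<omega>\<^sub>4, \<omega>\<^sub>5}" | "x \<in> {\<omega>\<^sub>5, \<omega>\<^sub>6, \<omega>\<^sub>1}"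
      using x assms(2) by auto
    then show ?thesis
    proof cases
      case 1
      then show ?thesis by (rule lines(1)) simp
    next
      case 2
      then have "(x, \<omega>\<^sub>3) \<in> ?R\<^sup>*" by (rule lines(2)) simp
      also have "(\<omega>\<^sub>3, \<omega>\<^sub>1) \<in> ?R\<^sup>*" by (rule lines(1)) simp_all
      finally show ?thesis .
    next
      case 3
      then show ?thesis by (rule lines(3)) simp
    qed
  qed
  have "sym (?R\<^sup>*)" by (intro sym_rtrancl) (auto simp: sym_def)
  then show "(x, y) \<in> ?R\<^sup>*" if "x \<in> \<Omega>" "y \<in> \<Omega>" for x y
    using to_vertex[OF that(1)] to_vertex[OF that(2)] by (meson rtrancl_trans symD)
  fix v :: "'a \<Rightarrow> complex"
  assume v: "v \<in> augmentation \<Omega>" and sums: "\<And>\<pi> b. \<pi> \<in> \<B> \<Longrightarrow> b \<in> \<pi> \<Longrightarrow> sum v b = 0"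
  let ?\<pi>1 = "{{\<omega>\<^sub>1, \<omega>\<^sub>4}, {\<omega>\<^sub>3, \<omega>\<^sub>6}, {\<omega>\<^sub>2, \<omega>\<^sub>5}}" and ?\<pi>2 = "{{\<omega>\<^sub>1, \<omega>\<^sub>2, \<omega>\<^sub>3}, {\<omega>\<^sub>5}, {\<omega>\<^sub>4, \<omega>\<^sub>6}}"
    and ?\<pi>3 = "{{\<omega>\<^sub>3, \<omega>\<^sub>4, \<omega>\<^sub>5}, {\<omega>\<^sub>1}, {\<omega>\<^sub>6, \<omega>\<^sub>2}}" and ?\<pi>4 = "{{\<omega>\<^sub>5, \<omega>\<^sub>6, \<omega>\<^sub>1}, {\<omega>\<^sub>3}, {\<omega>\<^sub>2, \<omega>\<^sub>4}}"
  have "\<B> \<subseteq> {?\<pi>1, ?\<pi>2, ?\<pi>3, ?\<pi>4}"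
  proof
    fix \<pi> assume "\<pi> \<in> \<B>"
    with assms(4) have \<pi>: "partition_on \<Omega> \<pi>" "card \<pi> = 3" "\<pi> \<in> \<B>" by blast+
    show "\<pi> \<in> {?\<pi>1, ?\<pi>2, ?\<pi>3, ?\<pi>4}"
      by (rule compatible_partition_cases[OF assms(1,2) \<pi> assms(5)]) (simp_all add: assms(3))
  qed
  moreover have "card \<B> \<ge> 3" using assms(6) by auto
  ultimately
  have three: "?\<pi>2 \<in> \<B> \<and> ?\<pi>3 \<in> \<B> \<and> ?\<pi>4 \<in> \<B> \<or> ?\<pi>1 \<in> \<B> \<and> ?\<pi>3 \<in> \<B> \<and> ?\<pi>4 \<in> \<B>
      \<or> ?\<pi>1 \<in> \<B> \<and> ?\<pi>2 \<in> \<B> \<and> ?\<pi>4 \<in> \<B> \<or> ?\<pi>1 \<in> \<B> \<and> ?\<pi>2 \<in> \<B> \<and> ?\<pi>3 \<in> \<B>"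
    by (rule omit_at_most_one)
  \<comment> \<open>The blocks obtained by rotation list their points out of order; these
    orientations of the inequalities let the simplifier expand the sums over them.\<close>
  have neq: "\<omega>\<^sub>6 \<noteq> \<omega>\<^sub>2" "\<omega>\<^sub>5 \<noteq> \<omega>\<^sub>1" "\<omega>\<^sub>6 \<noteq> \<omega>\<^sub>1" using assms(1) by auto
  have E1: "v \<omega>\<^sub>1 + v \<omega>\<^sub>4 = 0 \<and> v \<omega>\<^sub>3 + v \<omega>\<^sub>6 = 0 \<and> v \<omega>\<^sub>2 + v \<omega>\<^sub>5 = 0" if "?\<pi>1 \<in> \<B>"
    using sums[OF that, of "{\<omega>\<^sub>1, \<omega>\<^sub>4}"] sums[OF that, of "{\<omega>\<^sub>3, \<omega>\<^sub>6}"] sums[OF that, of "{\<omega>\<^sub>2, \<omega>\<^sub>5}"]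
      assms(1) neq by simp
  have E2: "v \<omega>\<^sub>1 + (v \<omega>\<^sub>2 + v \<omega>\<^sub>3) = 0 \<and> v \<omega>\<^sub>5 = 0 \<and> v \<omega>\<^sub>4 + v \<omega>\<^sub>6 = 0" if "?\<pi>2 \<in> \<B>"
    using sums[OF that, of "{\<omega>\<^sub>1, \<omega>\<^sub>2, \<omega>\<^sub>3}"] sums[OF that, of "{\<omega>\<^sub>5}"] sums[OF that, of "{\<omega>\<^sub>4, \<omega>\<^sub>6}"]
      assms(1) neq by simp
  have E3: "v \<omega>\<^sub>3 + (v \<omega>\<^sub>4 + v \<omega>\<^sub>5) = 0 \<and> v \<omega>\<^sub>1 = 0 \<and> v \<omega>\<^sub>6 + v \<omega>\<^sub>2 = 0" if "?\<pi>3 \<in> \<B>"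
    using sums[OF that, of "{\<omega>\<^sub>3, \<omega>\<^sub>4, \<omega>\<^sub>5}"] sums[OF that, of "{\<omega>\<^sub>1}"] sums[OF that, of "{\<omega>\<^sub>6, \<omega>\<^sub>2}"]
      assms(1) neq by simp
  have E4: "v \<omega>\<^sub>5 + (v \<omega>\<^sub>6 + v \<omega>\<^sub>1) = 0 \<and> v \<omega>\<^sub>3 = 0 \<and> v \<omega>\<^sub>2 + v \<omega>\<^sub>4 = 0" if "?\<pi>4 \<in> \<B>"
    using sums[OF that, of "{\<omega>\<^sub>5, \<omega>\<^sub>6, \<omega>\<^sub>1}"] sums[OF that, of "{\<omega>\<^sub>3}"] sums[OF that, of "{\<omega>\<^sub>2, \<omega>\<^sub>4}"]
      assms(1) neq by simp
  have "v \<omega>\<^sub>1 = 0 \<and> v \<omega>\<^sub>2 = 0 \<and> v \<omega>\<^sub>3 = 0 \<and> v \<omega>\<^sub>4 = 0 \<and> v \<omega>\<^sub>5 = 0 \<and> v \<omega>\<^sub>6 = 0"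
    by (rule three_block_equations_zero[OF three E1 E2 E3 E4])
  then have "v x = 0" if "x \<in> \<Omega>" for x using that assms(2) by auto
  with v show "v = (\<lambda>x. 0)" by (auto simp: augmentation_def)
qed

end
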